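(* Binary concatenation is definable in the first-order theory of the structure $\mathfrak{S}_{\sqsubseteq,f,c}=\langle\Sigma^*,(s)_{s\in\Sigma^*},f,\sqsubseteq\rangle$; that is, there is a first-order formula $\varphi(x,y,z)$ in the vocabulary of this structure such that for all $r,s,t\in\Sigma^*$, $\mathfrak{S}_{\sqsubseteq,f,c}\models\varphi(r,s,t)$ if and only if $r^\frown s=t$.
   Context: $\Sigma^*$ is the set of finite words over the alphabet $\{1,2\}$, including the empty word; $^\frown$ is concatenation of words. The vocabulary consists of a constant $\underline{s}$ for each $s\in\Sigma^*$ (denoting $s$), a unary function symbol $f$, interpreted as reversal of words ($f(w)=w^{-1}$), and a binary relation symbol $\sqsubseteq$, where $s\sqsubseteq t$ means that $s$ is an initial segment of $t$ ($t=s^\frown u$ for some $u\in\Sigma^*$). Formulas are first-order with equality. *)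

theory Defs
  imports Main "HOL-Library.Sublist"
begin

datatype letter = L1 | L2

type_synonym word = "letter list"

text \<open>
  First-order language with equality over the vocabulary consisting of a constant symbol for
  every word, a unary function symbol and a binary relation symbol. Variables are named by
  natural numbers.
\<close>

datatype trm =
    Var nat
  | Const word
  | Fun trm

datatype fm =
    Eq trm trm
  | Rel trm trm
  | Neg fm
  | Conj fm fm
  | Disj fm fm
  | Imp fm fm
  | Forall nat fm
  | Exists nat fm

primrec vars :: "trm \<Rightarrow> nat set" where
  "vars (Var n) = {n}"
| "vars (Const w) = {}"
| "vars (Fun t) = vars t"

primrec free_vars :: "fm \<Rightarrow> nat set" where
  "free_vars (Eq t u) = vars t \<union> vars u"
| "free_vars (Rel t u) = vars t \<union> vars u"
| "free_vars (Neg p) = free_vars p"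
| "free_vars (Conj p q) = free_vars p \<union> free_vars q"
| "free_vars (Disj p q) = free_vars p \<union> free_vars q"
| "free_vars (Imp p q) = free_vars p \<union> free_vars q"
| "free_vars (Forall n p) = free_vars p - {n}"
| "free_vars (Exists n p) = free_vars p - {n}"

text \<open>Structures for this vocabulary; the universe is the whole type \<open>'a\<close>.\<close>

record 'a struct =
  const_int :: "word \<Rightarrow> 'a"
  fun_int :: "'a \<Rightarrow> 'a"
  rel_int :: "'a \<Rightarrow> 'a \<Rightarrow> bool"

primrec val :: "'a struct \<Rightarrow> (nat \<Rightarrow> 'a) \<Rightarrow> trm \<Rightarrow> 'a" where
  "val M e (Var n) = e n"
| "val M e (Const w) = const_int M w"
| "val M e (Fun t) = fun_int M (val M e t)"

primrec sat :: "'a struct \<Rightarrow> (nat \<Rightarrow> 'a) \<Rightarrow> fm \<Rightarrow> bool" where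
  "sat M e (Eq t u) \<longleftrightarrow> val M e t = val M e u"
| "sat M e (Rel t u) \<longleftrightarrow> rel_int M (val M e t) (val M e u)"
| "sat M e (Neg p) \<longleftrightarrow> \<not> sat M e p"
| "sat M e (Conj p q) \<longleftrightarrow> sat M e p \<and> sat M e q"
| "sat M e (Disj p q) \<longleftrightarrow> sat M e p \<or> sat M e q"
| "sat M e (Imp p q) \<longleftrightarrow> (sat M e p \<longrightarrow> sat M e q)"
| "sat M e (Forall n p) \<longleftrightarrow> (\<forall>a. sat M (e(n := a)) p)"
| "sat M e (Exists n p) \<longleftrightarrow> (\<exists>a. sat M (e(n := a)) p)"

definition word_struct :: "word struct" where
  "word_struct = \<lparr>const_int = (\<lambda>s. s), fun_int = rev, rel_int = prefix\<rparr>"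

end

theory Submission imports Defs begin

text \<open>
  Write 1, 2 for the letters. Appending a fixed letter is definable, as the immediate extension
  in the prefix order that has this letter as a suffix. So is the concatenation of an arbitrary
  word with a word \<open>21\<^sup>n\<close>: beyond its prefix \<open>x2\<close>, every prefix of the result ends in 1.
  By reversal, \<open>1\<^sup>n2q\<close> is definable as well, and a pair \<open>(p, q)\<close> can be coded by
  \<open>x = p21\<^sup>n2q\<close>, the word with suffix \<open>1\<^sup>n2q\<close> whose only prefix ending in \<open>1\<^sup>n2\<close>
  is \<open>p21\<^sup>n2\<close>. A finite set of such codes is coded by a word \<open>w\<close> having all the blocks
  \<open>1\<^sup>N2x21\<^sup>N\<close> as factors, for \<open>N\<close> large. Now \<open>rs = t\<close> holds iff some such finite set
  contains \<open>(r, \<epsilon>)\<close> and, with every pair \<open>(p, q)\<close> other than \<open>(t, s)\<close>, also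
  \<open>(pa, qa)\<close> for some letter \<open>a\<close>: following these successors from \<open>(r, \<epsilon>)\<close>, which
  preserves \<open>p = rq\<close>, must end, and it can only end in \<open>(t, s)\<close>.
\<close>

subsection \<open>Words with long runs of one letter\<close>

abbreviation run :: "nat \<Rightarrow> word" where
  "run n \<equiv> replicate n L1"

lemma run_prefix_before_L2:
  "run n @ A = t @ L2 # B \<Longrightarrow> \<exists>t'. t = run n @ t' \<and> A = t' @ L2 # B"
proof (induction n arbitrary: t)
  case (Suc n)
  then show ?case by (cases t) auto
qed simp

text \<open>A run starting within \<open>y\<close> or right at its end would have to cross the
  \<open>L2\<close> after \<open>y\<close>, because \<open>y\<close> is shorter than the
  run.\<close>

lemma run_occurrence_past_short_word:
  assumes "z @ run n @ A = y @ L2 # E" "length y < n"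
  shows "\<exists>z'. z = y @ L2 # z' \<and> E = z' @ run n @ A"
proof -
  from assms(1) consider
      us where "z @ us = y" "run n @ A = us @ L2 # E"
    | us where "z = y @ us" "us @ run n @ A = L2 # E"
    by (auto simp: append_eq_append_conv2)
  then show ?thesis
  proof cases
    case 1
    from run_prefix_before_L2[OF 1(2)] 1(1) assms(2) show ?thesis by auto
  next
    case 2
    have "us \<noteq> []" using 2(2) assms(2) by (cases n) auto
    with 2 show ?thesis by (cases us) auto
  qed
qed

text \<open>Two different occurrences of \<open>run n @ [L2]\<close> cannot overlap: the only
  \<open>L2\<close> is the last letter.\<close>

lemma run_L2_occurrence_past_run:
  assumes "z @ run n @ L2 # A = run n @ L2 # B"
  shows "z = [] \<or> (\<exists>z'. z = run n @ L2 # z' \<and> B = z' @ run n @ L2 # A)"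
proof (cases "z = []")
  case False
  from assms have "run n @ L2 # B = (z @ run n) @ L2 # A" by simp
  from run_prefix_before_L2[OF this] obtain t where
    t: "z @ run n = run n @ t" "L2 # B = t @ L2 # A" by blast
  from t(1) have "length z = length t"
    by (metis add.commute add_right_cancel length_append)
  with False t(2) obtain t1 where t1: "t = L2 # t1" "B = t1 @ L2 # A" by (cases t) auto
  from t(1) t1 have "z @ run n = (run n @ [L2]) @ t1" by simp
  then consider us where "z @ us = run n @ [L2]" "run n = us @ t1"
    | us where "z = (run n @ [L2]) @ us" "us @ run n = t1"
    unfolding append_eq_append_conv2 by metis
  then show ?thesis
  proof cases
    case 1
    \<comment> \<open>Otherwise the final \<open>L2\<close> of \<open>run n @ [L2]\<close> would
      belong to \<open>us\<close>, which is a prefix of \<open>run n\<close>.\<close>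
    have "us = []"
    proof (rule ccontr)
      assume "us \<noteq> []"
      with 1(1) have "L2 \<in> set us" by (metis last_appendR last_in_set last_snoc)
      with 1(2) have "L2 \<in> set (run n)" by simp
      then show False by simp
    qed
    with 1 t1 show ?thesis by auto
  next
    case 2
    with t1 show ?thesis by auto
  qed
qed simp

text \<open>Both numbers are the length of the maximal run of \<open>L1\<close> at the end of the
  word.\<close>

lemma append_run_unique:
  assumes "v @ L2 # run n = x @ L2 # run m"
  shows "n = m"
proof -
  have "takeWhile (\<lambda>a. a = L1) (rev (v @ L2 # run n)) = run n" for n v
    by (simp add: takeWhile_append)
  with assms show ?thesis by (metis length_replicate)
qed

text \<open>An occurrence of \<open>m\<close> is identified with the prefix of \<open>x\<close> that
  ends with it. That such an occurrence exists is not part of the condition.\<close>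

definition occurs_only_at :: "word \<Rightarrow> word \<Rightarrow> word \<Rightarrow> bool" where
  "occurs_only_at m y0 x \<longleftrightarrow> (\<forall>y. prefix y x \<and> suffix m y \<longrightarrow> y = y0)"

text \<open>As \<open>p\<close> is shorter than the run, an occurrence starts after
  \<open>p @ [L2]\<close>; a second one would then lie inside \<open>q\<close>, which is too
  short.\<close>

lemma separator_occurs_only_once:
  assumes "length p < n" "length q < n"
  shows "occurs_only_at (run n @ [L2]) (p @ L2 # run n @ [L2]) (p @ L2 # run n @ L2 # q)"
  unfolding occurs_only_at_def
proof (intro allI impI, elim conjE)
  fix y assume "prefix y (p @ L2 # run n @ L2 # q)" "suffix (run n @ [L2]) y"
  then obtain v z where y: "y = v @ run n @ [L2]"
    and e: "v @ run n @ L2 # z = p @ L2 # run n @ L2 # q"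
    by (auto simp: prefix_def suffix_def)
  from run_occurrence_past_short_word[OF e assms(1)] obtain v1 where
    v1: "v = p @ L2 # v1" "v1 @ run n @ L2 # z = run n @ L2 # q" by auto
  from run_L2_occurrence_past_run[OF v1(2)] have "v1 = []"
  proof
    assume "\<exists>z'. v1 = run n @ L2 # z' \<and> q = z' @ run n @ L2 # z"
    with assms(2) show ?thesis by auto
  qed
  with v1 y show "y = p @ L2 # run n @ [L2]" by simp
qed

section \<open>Coding finite sets of words by blocks between long runs\<close>

primrec blocks :: "nat \<Rightarrow> word list \<Rightarrow> word" where
  "blocks N [] = run N"
| "blocks N (x # xs) = run N @ L2 # x @ L2 # blocks N xs"

lemma blocks_begin_with_run: "\<exists>E. blocks N xs = run N @ E"
  by (cases xs) auto

lemma block_sublist_blocks: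
  "x \<in> set xs \<Longrightarrow> sublist (run N @ L2 # x @ L2 # run N) (blocks N xs)"
proof (induction xs)
  case (Cons y ys)
  show ?case
  proof (cases "x = y")
    case True
    obtain E where "blocks N ys = run N @ E" using blocks_begin_with_run by blast
    with True have "blocks N (y # ys) = [] @ (run N @ L2 # x @ L2 # run N) @ E" by simp
    then show ?thesis unfolding sublist_def by blast
  next
    case False
    with Cons have "sublist (run N @ L2 # x @ L2 # run N) (blocks N ys)" by auto
    then have "sublist (run N @ L2 # x @ L2 # run N) ((run N @ L2 # y @ [L2]) @ blocks N ys)"
      unfolding sublist_append by blast
    then show ?thesis by simp
  qed
qed simp

text \<open>An occurrence of the block either starts at the first run or lies past \<open>y\<close>,
  where the induction applies. In the first case an \<open>x\<close> other than \<open>y\<close>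
  would reach beyond the run after \<open>y\<close> and so contain \<open>L2 # run N\<close>, which
  the last hypothesis excludes.\<close>

lemma block_of_blocks:
  assumes "z @ run N @ L2 # x @ L2 # run N @ z' = blocks N xs"
    and "\<forall>y\<in>set xs. length y < N" and "\<not> sublist (L2 # run N) x"
  shows "x \<in> set xs"
  using assms(1,2)
proof (induction xs arbitrary: z)
  case Nil
  then have "length (z @ run N @ L2 # x @ L2 # run N @ z') = length (run N)" by simp
  then show ?case by simp
next
  case (Cons y ys)
  then have ly: "length y < N" by simp
  have e: "z @ run N @ L2 # (x @ L2 # run N @ z') = run N @ L2 # y @ L2 # blocks N ys"
    using Cons.prems by simp
  from run_L2_occurrence_past_run[OF e] show ?case
  proof
    assume "z = []"
    obtain E where E: "blocks N ys = run N @ E" using blocks_begin_with_run by blast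
    with e \<open>z = []\<close> have "x @ L2 # run N @ z' = y @ L2 # run N @ E" by simp
    then have e1: "(x @ [L2]) @ run N @ z' = y @ L2 # run N @ E" by simp
    from run_occurrence_past_short_word[OF e1 ly] obtain z2 where
      z2: "x @ [L2] = y @ L2 # z2" "run N @ E = z2 @ run N @ z'" by blast
    show ?thesis
    proof (cases z2 rule: rev_cases)
      case Nil
      with z2 show ?thesis by simp
    next
      case (snoc z3 a)
      with z2 have "a = L2" "x = y @ L2 # z3" "run N @ E = z3 @ L2 # run N @ z'" by auto
      with run_prefix_before_L2[of N E z3] obtain z4 where "x = y @ (L2 # run N) @ z4" by auto
      with assms(3) show ?thesis by (auto simp: sublist_def)
    qed
  next
    assume "\<exists>z1. z = run N @ L2 # z1 \<and>
      y @ L2 # blocks N ys = z1 @ run N @ L2 # x @ L2 # run N @ z'"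
    then obtain z1 where "z1 @ run N @ L2 # x @ L2 # run N @ z' = y @ L2 # blocks N ys" by auto
    from run_occurrence_past_short_word[OF this ly] obtain z2 where
      "z2 @ run N @ L2 # x @ L2 # run N @ z' = blocks N ys" by auto
    from Cons.IH[OF this] Cons.prems(2) show ?thesis by simp
  qed
qed

subsection \<open>Auxiliary relations on words\<close>

definition append_run :: "word \<Rightarrow> word \<Rightarrow> word \<Rightarrow> bool" where
  "append_run x m u \<longleftrightarrow> prefix (x @ [L2]) u \<and> suffix m u \<and>
     (\<forall>y. prefix y u \<longrightarrow> prefix y (x @ [L2]) \<or> suffix [L1] y)"

lemma rev_eq_append_run: "rev b = rev q @ L2 # run n \<longleftrightarrow> b = run n @ L2 # q"
  by (subst rev_swap) simp

text \<open>Each letter of \<open>u\<close> after \<open>x @ [L2]\<close> ends a prefix longer than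
  \<open>x @ [L2]\<close>, so it is \<open>L1\<close>. The suffix then fixes how many there
  are.\<close>

lemma append_run_iff:
  "append_run x (L2 # run n) u \<longleftrightarrow> u = x @ L2 # run n"
proof
  assume h: "append_run x (L2 # run n) u"
  then have "prefix (x @ [L2]) u" "suffix (L2 # run n) u" by (simp_all add: append_run_def)
  then obtain k v where "u = (x @ [L2]) @ k" and v: "u = v @ L2 # run n"
    by (elim prefixE suffixE)
  then have k: "u = x @ L2 # k" by simp
  have "a = L1" if "a \<in> set k" for a
  proof -
    from that obtain k1 k2 where "k = k1 @ a # k2" by (meson split_list)
    with k have "prefix (x @ L2 # k1 @ [a]) u" by (simp add: prefix_def)
    with h have "prefix (x @ L2 # k1 @ [a]) (x @ [L2]) \<or> suffix [L1] (x @ L2 # k1 @ [a])"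
      unfolding append_run_def by blast
    moreover have "\<not> prefix (x @ L2 # k1 @ [a]) (x @ [L2])"
      by (auto dest: prefix_length_le)
    ultimately have "suffix [L1] (x @ L2 # k1 @ [a])" by blast
    then show ?thesis by (auto simp: suffix_def)
  qed
  then have "k = run (length k)" by (intro replicate_eqI refl)
  then obtain j where j: "k = run j" by (rule that)
  from k v have "v @ L2 # run n = x @ L2 # run j" unfolding j by metis
  from append_run_unique[OF this] show "u = x @ L2 # run n" unfolding k j by simp
next
  assume u: "u = x @ L2 # run n"
  have "prefix y (x @ [L2]) \<or> suffix [L1] y" if y: "prefix y u" for y
  proof -
    from y u have "prefix y ((x @ [L2]) @ run n)" by simp
    then consider "prefix y (x @ [L2])" | k where "y = (x @ [L2]) @ k" "prefix k (run n)"
      unfolding prefix_append by blast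
    then show ?thesis
    proof cases
      case 2
      then have "set k \<subseteq> {L1}" using set_mono_prefix[of k "run n"] by auto
      with 2(1) show ?thesis by (cases k rule: rev_cases) (simp_all add: suffix_def)
    qed simp
  qed
  moreover have "prefix (x @ [L2]) u" by (rule prefixI[of _ _ "run n"]) (simp add: u)
  moreover have "suffix (L2 # run n) u" by (rule suffixI) (rule u)
  ultimately show "append_run x (L2 # run n) u" unfolding append_run_def by blast
qed

text \<open>\<open>append_run\<close> extends words on the right only; with \<open>rev\<close> it
  makes \<open>b\<close> the extension of \<open>q\<close> on the left.\<close>

definition pair_code :: "word \<Rightarrow> word \<Rightarrow> word \<Rightarrow> word \<Rightarrow> bool" where
  "pair_code R p q x \<longleftrightarrow> (\<exists>a b. append_run p R a \<and> append_run (rev q) R (rev b) \<and>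
     suffix b x \<and> occurs_only_at (rev R) (a @ [L2]) x)"

text \<open>The suffix \<open>run n @ L2 # q\<close> provides an occurrence of the separator in
  \<open>x\<close>. As this can only be the one ending \<open>p @ L2 # run n @ [L2]\<close>, the
  part of \<open>x\<close> before \<open>q\<close> is determined.\<close>

lemma pair_code_iff:
  "pair_code (L2 # run n) p q x \<longleftrightarrow> x = p @ L2 # run n @ L2 # q \<and>
     occurs_only_at (run n @ [L2]) (p @ L2 # run n @ [L2]) x"
proof -
  have "pair_code (L2 # run n) p q x \<longleftrightarrow> suffix (run n @ L2 # q) x \<and>
     occurs_only_at (run n @ [L2]) (p @ L2 # run n @ [L2]) x"
    unfolding pair_code_def append_run_iff rev_eq_append_run by simp
  moreover have "x = p @ L2 # run n @ L2 # q"
    if "suffix (run n @ L2 # q) x" "occurs_only_at (run n @ [L2]) (p @ L2 # run n @ [L2]) x"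
  proof -
    from that(1) obtain v where v: "x = v @ run n @ L2 # q" by (auto simp: suffix_def)
    then have "prefix (v @ run n @ [L2]) x" "suffix (run n @ [L2]) (v @ run n @ [L2])"
      by (auto simp: prefix_def suffix_def)
    with that(2) have "v @ run n @ [L2] = p @ L2 # run n @ [L2]"
      unfolding occurs_only_at_def by blast
    then have "v = p @ [L2]" by (metis append.assoc append_Cons append_Nil append_same_eq)
    with v show ?thesis by simp
  qed
  moreover have "suffix (run n @ L2 # q) (p @ L2 # run n @ L2 # q)"
    by (auto simp: suffix_def intro!: exI[of _ "p @ [L2]"])
  ultimately show ?thesis by blast
qed

text \<open>For \<open>M = L2 # run N\<close>, the word \<open>c\<close> is the block around
  \<open>x\<close>. Excluding \<open>M\<close> from \<open>x\<close> keeps \<open>x\<close> from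
  stretching over several blocks of \<open>w\<close>.\<close>

definition listed :: "word \<Rightarrow> word \<Rightarrow> word \<Rightarrow> word \<Rightarrow> word \<Rightarrow> bool" where
  "listed R M w p q \<longleftrightarrow> (\<exists>x u c. pair_code R p q x \<and> \<not> sublist M x \<and>
     append_run x M u \<and> append_run (rev u) M (rev c) \<and> sublist c w)"

text \<open>This bound holds for arbitrary \<open>R\<close> and \<open>M\<close>, so the defining formula need not
  force the markers to be of the form \<open>21\<^sup>n\<close>.\<close>

lemma listed_length:
  assumes "listed R M w p q" shows "length q \<le> length w"
proof -
  from assms obtain x u c b where
    "append_run (rev q) R (rev b)" "suffix b x" "append_run x M u"
    "append_run (rev u) M (rev c)" "sublist c w"
    unfolding listed_def pair_code_def by blast
  then have "length q \<le> length b" "length b \<le> length x" "length x \<le> length u"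
    "length u \<le> length c" "length c \<le> length w"
    by (auto simp: append_run_def dest!: prefix_length_le suffix_length_le sublist_length_le)
  then show ?thesis by linarith
qed

lemma listed_iff:
  "listed (L2 # run n) (L2 # run N) w p q \<longleftrightarrow>
     occurs_only_at (run n @ [L2]) (p @ L2 # run n @ [L2]) (p @ L2 # run n @ L2 # q) \<and>
     \<not> sublist (L2 # run N) (p @ L2 # run n @ L2 # q) \<and>
     sublist (run N @ L2 # (p @ L2 # run n @ L2 # q) @ L2 # run N) w"
proof -
  show ?thesis
    unfolding listed_def append_run_iff pair_code_iff rev_eq_append_run by auto
qed

section \<open>Concatenation expressed by chains of listed pairs\<close>

lemma concat_iff_listed:
  "r @ s = t \<longleftrightarrow> (\<exists>R M w. listed R M w r [] \<and>
     (\<forall>p q. listed R M w p q \<longrightarrow> p = t \<and> q = s \<or>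
        (\<exists>a. listed R M w (p @ [a]) (q @ [a]))))" (is "_ \<longleftrightarrow> ?rhs")
proof
  assume ?rhs
  then obtain R M w where start: "listed R M w r []"
    and step: "\<And>p q. listed R M w p q \<Longrightarrow> p = t \<and> q = s \<or>
        (\<exists>a. listed R M w (p @ [a]) (q @ [a]))" by blast
  \<comment> \<open>Appending the same letter to both components keeps the form
    \<open>(r @ q, q)\<close>. By \<open>listed_length\<close> the successor's \<open>q\<close>
    still fits into \<open>w\<close>, so the measure strictly decreases.\<close>
  have "r @ s = t" if "listed R M w (r @ q) q" for q
    using that
  proof (induction "length w - length q" arbitrary: q rule: less_induct)
    case less
    from step[OF less.prems] show ?case
    proof
      assume "\<exists>a. listed R M w ((r @ q) @ [a]) (q @ [a])"
      then obtain a where a: "listed R M w (r @ q @ [a]) (q @ [a])" by auto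
      from listed_length[OF this] have "length w - length (q @ [a]) < length w - length q" by simp
      from less.hyps[OF this a] show ?thesis .
    qed auto
  qed
  from this[of "[]"] start show "r @ s = t" by simp
next
  assume t: "r @ s = t"
  \<comment> \<open>This exceeds the length of every \<open>pr i\<close> and
    \<open>take i s\<close>, all of which are at most as long as \<open>t\<close>.\<close>
  define n where "n = Suc (length t)"
  define pr where "pr i = r @ take i s" for i
  define x where "x i = pr i @ L2 # run n @ L2 # take i s" for i
  \<comment> \<open>Each \<open>x i\<close> has length at most \<open>3 * n\<close>, so it cannot
    contain a run of length \<open>N\<close>.\<close>
  define N where "N = 3 * n + 3"
  define w where "w = blocks N (map x [0..<Suc (length s)])"
  have len: "length (pr i) < n" "length (take i s) < n" for i
    using t by (auto simp: n_def pr_def)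
  have lenx: "length (x i) < N" for i
    using len[of i] by (simp add: x_def N_def)
  have once: "occurs_only_at (run n @ [L2]) (pr i @ L2 # run n @ [L2]) (x i)" for i
    unfolding x_def using separator_occurs_only_once len by blast
  have listed: "listed (L2 # run n) (L2 # run N) w (pr i) (take i s)" if "i \<le> length s" for i
  proof -
    have "x i \<in> set (map x [0..<Suc (length s)])" using that by (simp del: upt_Suc)
    from block_sublist_blocks[OF this, of N] once[of i] lenx[of i] show ?thesis
      unfolding listed_iff w_def x_def by (auto dest: sublist_length_le)
  qed
  \<comment> \<open>The word \<open>w\<close> must list no unintended pairs, since the step
    condition is required of every listed pair.\<close>
  have only: "\<exists>i\<le>length s. p = pr i \<and> q = take i s"
    if "listed (L2 # run n) (L2 # run N) w p q" for p q
  proof -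
    let ?y = "p @ L2 # run n @ L2 # q"
    from that have o: "occurs_only_at (run n @ [L2]) (p @ L2 # run n @ [L2]) ?y"
      and ns: "\<not> sublist (L2 # run N) ?y"
      and sub: "sublist (run N @ L2 # ?y @ L2 # run N) w"
      unfolding listed_iff by blast+
    from sub obtain z z' where z: "z @ run N @ L2 # ?y @ L2 # run N @ z' = w"
      by (auto simp: sublist_def)
    from block_of_blocks[OF z[unfolded w_def] _ ns] lenx
    have "?y \<in> x ` {..<Suc (length s)}" by (simp add: atLeast0LessThan del: upt_Suc)
    then obtain i where i: "i \<le> length s" "?y = x i" by (metis imageE lessThan_iff less_Suc_eq_le)
    \<comment> \<open>Equality of the codes does not by itself give equality of the pairs. The
      separator after \<open>pr i\<close> is an occurrence in \<open>x i\<close>, so uniqueness in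
      the code of \<open>(p, q)\<close> identifies the two splittings.\<close>
    have "prefix (pr i @ L2 # run n @ [L2]) (x i)" by (simp add: x_def)
    moreover have "suffix (run n @ [L2]) (pr i @ L2 # run n @ [L2])"
      by (auto simp: suffix_def intro!: exI[of _ "pr i @ [L2]"])
    ultimately have "pr i @ L2 # run n @ [L2] = p @ L2 # run n @ [L2]"
      using o[unfolded occurs_only_at_def] i(2) by metis
    then have "pr i = p" by simp
    with i show ?thesis by (auto simp: x_def)
  qed
  show ?rhs
  proof (intro exI conjI allI impI)
    show "listed (L2 # run n) (L2 # run N) w r []" using listed[of 0] by (simp add: pr_def)
  next
    fix p q assume "listed (L2 # run n) (L2 # run N) w p q"
    from only[OF this] obtain i where i: "i \<le> length s" "p = pr i" "q = take i s" by blast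
    show "p = t \<and> q = s \<or> (\<exists>a. listed (L2 # run n) (L2 # run N) w (p @ [a]) (q @ [a]))"
    proof (cases "i = length s")
      case True
      with i t show ?thesis by (simp add: pr_def)
    next
      case False
      \<comment> \<open>The appended letter is \<open>s ! i\<close>.\<close>
      with i listed[of "Suc i"] show ?thesis
        by (auto simp: pr_def take_Suc_conv_app_nth)
    qed
  qed
qed

subsection \<open>Defining formulas\<close>

text \<open>In the formulas below all bound variables are numbered from \<open>k\<close> upwards, so they are
  correct for terms whose variables are below \<open>k\<close>.\<close>

lemma val_fun_upd_fresh [simp]: "n \<notin> vars t \<Longrightarrow> val M (e(n := a)) t = val M e t"
  by (induction t) auto

lemma word_struct_simps [simp]:
  "const_int word_struct s = s" "fun_int word_struct s = rev s"
  "rel_int word_struct x y \<longleftrightarrow> prefix x y"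
  by (simp_all add: word_struct_def)

definition suffix_fm :: "trm \<Rightarrow> trm \<Rightarrow> fm" where
  "suffix_fm x y = Rel (Fun x) (Fun y)"

lemma sat_suffix_fm [simp]:
  "sat word_struct e (suffix_fm x y) \<longleftrightarrow> suffix (val word_struct e x) (val word_struct e y)"
  by (simp add: suffix_fm_def suffix_to_prefix)

definition sublist_fm :: "nat \<Rightarrow> trm \<Rightarrow> trm \<Rightarrow> fm" where
  "sublist_fm k x y = Exists k (Conj (Rel (Var k) y) (suffix_fm x (Var k)))"

lemma sat_sublist_fm [simp]:
  assumes "k \<notin> vars x" "k \<notin> vars y"
  shows "sat word_struct e (sublist_fm k x y) \<longleftrightarrow>
    sublist (val word_struct e x) (val word_struct e y)"
  using assms by (auto simp: sublist_fm_def sublist_altdef)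

definition snoc_fm :: "nat \<Rightarrow> letter \<Rightarrow> trm \<Rightarrow> trm \<Rightarrow> fm" where
  "snoc_fm k a x y = Conj (Rel x y) (Conj (Neg (Eq x y)) (Conj (suffix_fm (Const [a]) y)
     (Forall k (Imp (Rel (Var k) y) (Disj (Eq (Var k) y) (Rel (Var k) x))))))"

text \<open>The last condition makes \<open>x\<close> the longest proper prefix of \<open>y\<close>,
  which is \<open>y\<close> without its last letter.\<close>

lemma snoc_iff:
  "y = x @ [a] \<longleftrightarrow> prefix x y \<and> x \<noteq> y \<and> suffix [a] y \<and> (\<forall>v. prefix v y \<longrightarrow> v = y \<or> prefix v x)"
  (is "_ \<longleftrightarrow> ?rhs")
proof
  assume h: ?rhs
  then obtain y' where y': "y = y' @ [a]" by (auto simp: suffix_def)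
  with h have "prefix x y'" by (metis prefix_snoc)
  moreover from h y' have "prefix y' x" by (metis append_self_conv not_Cons_self2 prefixI)
  ultimately show "y = x @ [a]" using y' by (simp add: prefix_order.antisym)
qed (auto simp: suffix_def prefix_snoc)

lemma sat_snoc_fm [simp]:
  assumes "k \<notin> vars x" "k \<notin> vars y"
  shows "sat word_struct e (snoc_fm k a x y) \<longleftrightarrow> val word_struct e y = val word_struct e x @ [a]"
  using assms unfolding snoc_iff by (simp add: snoc_fm_def)

text \<open>No term denotes \<open>y @ [L2]\<close>, so \<open>snoc_fm\<close> replaces an equation
  with it and \<open>y\<close> is passed without the final \<open>L2\<close>.\<close>

definition occurs_only_at_fm :: "nat \<Rightarrow> trm \<Rightarrow> trm \<Rightarrow> trm \<Rightarrow> fm" where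
  "occurs_only_at_fm k m y x =
     Forall k (Imp (Conj (Rel (Var k) x) (suffix_fm m (Var k))) (snoc_fm (k + 1) L2 y (Var k)))"

lemma sat_occurs_only_at_fm [simp]:
  assumes "vars m \<union> vars y \<union> vars x \<subseteq> {..<k}"
  shows "sat word_struct e (occurs_only_at_fm k m y x) \<longleftrightarrow>
    occurs_only_at (val word_struct e m) (val word_struct e y @ [L2]) (val word_struct e x)"
proof -
  from assms have "k \<notin> vars m" "k \<notin> vars y" "k \<notin> vars x" "k + 1 \<notin> vars y" by auto
  then show ?thesis by (simp add: occurs_only_at_fm_def occurs_only_at_def)
qed

definition append_run_fm :: "nat \<Rightarrow> trm \<Rightarrow> trm \<Rightarrow> trm \<Rightarrow> fm" where
  "append_run_fm k x m u = Exists k (Conj (snoc_fm (k + 1) L2 x (Var k))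
     (Conj (Rel (Var k) u) (Conj (suffix_fm m u)
       (Forall (k + 1) (Imp (Rel (Var (k + 1)) u)
         (Disj (Rel (Var (k + 1)) (Var k)) (suffix_fm (Const [L1]) (Var (k + 1)))))))))"

lemma sat_append_run_fm [simp]:
  assumes "vars x \<union> vars m \<union> vars u \<subseteq> {..<k}"
  shows "sat word_struct e (append_run_fm k x m u) \<longleftrightarrow>
    append_run (val word_struct e x) (val word_struct e m) (val word_struct e u)"
proof -
  from assms have "k \<notin> vars m" "k \<notin> vars u" "k \<notin> vars x" "k + 1 \<notin> vars x" "k + 1 \<notin> vars u"
    by auto
  then show ?thesis by (simp add: append_run_fm_def append_run_def)
qed

definition pair_code_fm :: "nat \<Rightarrow> trm \<Rightarrow> trm \<Rightarrow> trm \<Rightarrow> trm \<Rightarrow> fm" where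
  "pair_code_fm k R p q x = Exists k (Exists (k + 1)
     (Conj (append_run_fm (k + 2) p R (Var k))
     (Conj (append_run_fm (k + 2) (Fun q) R (Fun (Var (k + 1))))
     (Conj (suffix_fm (Var (k + 1)) x) (occurs_only_at_fm (k + 2) (Fun R) (Var k) x)))))"

text \<open>Supplies the side conditions of the satisfaction lemmas under nested
  quantifiers.\<close>

lemma lessThan_fresh:
  fixes k :: nat
  assumes "A \<subseteq> {..<k}"
  shows "k + i \<notin> A" "A \<subseteq> {..<k + i}" "k \<notin> A"
  using assms by force+

lemma sat_pair_code_fm [simp]:
  assumes "vars R \<union> vars p \<union> vars q \<union> vars x \<subseteq> {..<k}"
  shows "sat word_struct e (pair_code_fm k R p q x) \<longleftrightarrow>
    pair_code (val word_struct e R) (val word_struct e p) (val word_struct e q)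
      (val word_struct e x)"
proof -
  from assms have v: "vars R \<subseteq> {..<k}" "vars p \<subseteq> {..<k}" "vars q \<subseteq> {..<k}" "vars x \<subseteq> {..<k}"
    by auto
  note f = v[THEN lessThan_fresh(1)] v[THEN lessThan_fresh(2)]
  show ?thesis
    using v[THEN lessThan_fresh(3)] f[of 1] f[of 2] by (simp add: pair_code_fm_def pair_code_def)
qed

definition listed_fm :: "nat \<Rightarrow> trm \<Rightarrow> trm \<Rightarrow> trm \<Rightarrow> trm \<Rightarrow> trm \<Rightarrow> fm" where
  "listed_fm k R M w p q = Exists k (Exists (k + 1) (Exists (k + 2)
     (Conj (pair_code_fm (k + 3) R p q (Var k))
     (Conj (Neg (sublist_fm (k + 3) M (Var k)))
     (Conj (append_run_fm (k + 3) (Var k) M (Var (k + 1)))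
     (Conj (append_run_fm (k + 3) (Fun (Var (k + 1))) M (Fun (Var (k + 2))))
       (sublist_fm (k + 3) (Var (k + 2)) w)))))))"

lemma sat_listed_fm [simp]:
  assumes "vars R \<union> vars M \<union> vars w \<union> vars p \<union> vars q \<subseteq> {..<k}"
  shows "sat word_struct e (listed_fm k R M w p q) \<longleftrightarrow>
    listed (val word_struct e R) (val word_struct e M) (val word_struct e w)
      (val word_struct e p) (val word_struct e q)"
proof -
  from assms have v: "vars R \<subseteq> {..<k}" "vars M \<subseteq> {..<k}" "vars w \<subseteq> {..<k}"
    "vars p \<subseteq> {..<k}" "vars q \<subseteq> {..<k}"
    by auto
  note f = v[THEN lessThan_fresh(1)] v[THEN lessThan_fresh(2)]
  show ?thesis
    using v[THEN lessThan_fresh(3)] f[of 1] f[of 2] f[of 3] by (simp add: listed_fm_def listed_def)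
qed

text \<open>Variables 0, 1, 2 stand for \<open>r\<close>, \<open>s\<close>, \<open>t\<close>; 3, 4,
  5 for \<open>R\<close>, \<open>M\<close>, \<open>w\<close>; 6, 7 for \<open>p\<close>,
  \<open>q\<close>; and 8, 9 for the successor pair.\<close>

definition concat_fm :: fm where
  "concat_fm = Exists 3 (Exists 4 (Exists 5
     (Conj (listed_fm 6 (Var 3) (Var 4) (Var 5) (Var 0) (Const []))
     (Forall 6 (Forall 7 (Imp (listed_fm 8 (Var 3) (Var 4) (Var 5) (Var 6) (Var 7))
       (Disj (Conj (Eq (Var 6) (Var 2)) (Eq (Var 7) (Var 1)))
         (Exists 8 (Exists 9 (Conj (listed_fm 10 (Var 3) (Var 4) (Var 5) (Var 8) (Var 9))
           (Disj (Conj (snoc_fm 10 L1 (Var 6) (Var 8)) (snoc_fm 10 L1 (Var 7) (Var 9)))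
             (Conj (snoc_fm 10 L2 (Var 6) (Var 8)) (snoc_fm 10 L2 (Var 7) (Var 9))))))))))))))"

text \<open>Quantification over letters is replaced by quantification over words and a case
  distinction on the two letters, as \<open>concat_fm\<close> needs.\<close>

lemma ex_common_snoc_iff:
  "(\<exists>a. P (p @ [a]) (q @ [a])) \<longleftrightarrow> (\<exists>x y. P x y \<and>
     (x = p @ [L1] \<and> y = q @ [L1] \<or> x = p @ [L2] \<and> y = q @ [L2]))"
  (is "?lhs \<longleftrightarrow> ?rhs")
proof
  assume ?lhs
  then obtain a where "P (p @ [a]) (q @ [a])" by blast
  then show ?rhs by (cases a) blast+
qed blast

lemma sat_concat_fm:
  "sat word_struct (e(0 := r, 1 := s, 2 := t)) concat_fm \<longleftrightarrow> r @ s = t"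
  unfolding concat_iff_listed ex_common_snoc_iff concat_fm_def by simp

section \<open>Free variables of the defining formulas\<close>

lemma free_vars_snoc_fm: "free_vars (snoc_fm k a x y) \<subseteq> vars x \<union> vars y"
  by (auto simp: snoc_fm_def suffix_fm_def)

lemma free_vars_append_run_fm: "free_vars (append_run_fm k x m u) \<subseteq> vars x \<union> vars m \<union> vars u"
  using free_vars_snoc_fm[of "k + 1" L2 x "Var k"]
  by (auto simp: append_run_fm_def suffix_fm_def)

lemma free_vars_pair_code_fm:
  "free_vars (pair_code_fm k R p q x) \<subseteq> vars R \<union> vars p \<union> vars q \<union> vars x"
  using free_vars_append_run_fm[of "k + 2" p R "Var k"]
    free_vars_append_run_fm[of "k + 2" "Fun q" R "Fun (Var (k + 1))"]
    free_vars_snoc_fm[of "k + 3" L2 "Var k" "Var (k + 2)"]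
  by (auto simp: pair_code_fm_def occurs_only_at_fm_def suffix_fm_def numeral_eq_Suc)

lemma free_vars_listed_fm:
  "free_vars (listed_fm k R M w p q) \<subseteq> vars R \<union> vars M \<union> vars w \<union> vars p \<union> vars q"
  using free_vars_pair_code_fm[of "k + 3" R p q "Var k"]
    free_vars_append_run_fm[of "k + 3" "Var k" M "Var (k + 1)"]
    free_vars_append_run_fm[of "k + 3" "Fun (Var (k + 1))" M "Fun (Var (k + 2))"]
  by (auto simp: listed_fm_def sublist_fm_def suffix_fm_def)

lemma free_vars_concat_fm: "free_vars concat_fm \<subseteq> {0, 1, 2}"
  using free_vars_listed_fm[of 6 "Var 3" "Var 4" "Var 5" "Var 0" "Const []"]
    free_vars_listed_fm[of 8 "Var 3" "Var 4" "Var 5" "Var 6" "Var 7"]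
    free_vars_listed_fm[of 10 "Var 3" "Var 4" "Var 5" "Var 8" "Var 9"]
    free_vars_snoc_fm[of 10 _ "Var 6" "Var 8"] free_vars_snoc_fm[of 10 _ "Var 7" "Var 9"]
  unfolding concat_fm_def free_vars.simps vars.simps by blast

theorem mainTheorem3:
  "\<exists>\<phi>. free_vars \<phi> \<subseteq> {0, 1, 2} \<and>
     (\<forall>(r::word) (s::word) (t::word) (e::nat \<Rightarrow> word).
        sat word_struct (e(0 := r, 1 := s, 2 := t)) \<phi> \<longleftrightarrow> r @ s = t)"
  using free_vars_concat_fm sat_concat_fm by blast

end
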